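(* Suppose that $\alpha<-1$ and $k\in\mathbb{N}_0$ with $k<2|\alpha|-1$. Then there exists a constant $A_{\alpha,k}>0$, depending only on $\alpha$ and $k$, such that for every $c\ge 1$, $$\big\|\widehat{L}_{\alpha,c}^{(k)}\big\|_{L_1(\mathbb{R})}\le A_{\alpha,k}\,c^{(2k+1)(2|\alpha|-\lfloor|\alpha|\rfloor-1)+k}.$$
   Context: $\mathbb{N}_0=\{0,1,2,\dots\}$. For $c>0$ and $\alpha\in\mathbb{R}\setminus\mathbb{N}_0$, the one-dimensional general multiquadric $\phi_{\alpha,c}(x)=(x^2+c^2)^\alpha$ has (generalized) Fourier transform $$\widehat{\phi}_{\alpha,c}(\xi)=\frac{2^{1+\alpha}}{\Gamma(-\alpha)}\Big(\frac{c}{|\xi|}\Big)^{\alpha+\frac12}K_{\alpha+\frac12}(c|\xi|),\quad \xi\neq 0,$$ where $K_\nu=K_{-\nu}$ is the modified Bessel function of the second kind. Set $$\widehat{L}_{\alpha,c}(\xi)=\frac{\widehat{\phi}_{\alpha,c}(\xi)}{\sum_{j\in\mathbb{Z}}\widehat{\phi}_{\alpha,c}(\xi+2\pi j)},\quad\xi\in\mathbb{R}$$ (extended by continuity to $\xi\in2\pi\mathbb{Z}$). $\widehat{L}_{\alpha,c}^{(k)}$ denotes the $k$-th derivative. *)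

theory Defs
  imports "HOL-Analysis.Analysis"
begin

text \<open>Modified Bessel function of the second kind, by its integral representation, which
  converges for all real \<open>\<nu>\<close> exactly when \<open>x > 0\<close>; only such \<open>x\<close> are meaningful.\<close>

definition bessel_K :: "real \<Rightarrow> real \<Rightarrow> real" where
  "bessel_K \<nu> x = (LBINT t:{0..}. exp (- x * cosh t) * cosh (\<nu> * t))"

text \<open>Generalized Fourier transform of \<open>x \<mapsto> (x\<^sup>2 + c\<^sup>2) powr \<alpha>\<close>;
  meaningful for \<open>\<xi> \<noteq> 0\<close> only.\<close>

definition multiquadric_hat :: "real \<Rightarrow> real \<Rightarrow> real \<Rightarrow> real" where
  "multiquadric_hat \<alpha> c \<xi> =
     2 powr (1 + \<alpha>) / Gamma (- \<alpha>) * (c / \<bar>\<xi>\<bar>) powr (\<alpha> + 1/2) * bessel_K (\<alpha> + 1/2) (c * \<bar>\<xi>\<bar>)"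

definition cardinal_quotient :: "real \<Rightarrow> real \<Rightarrow> real \<Rightarrow> real" where
  "cardinal_quotient \<alpha> c \<xi> =
     multiquadric_hat \<alpha> c \<xi> / (\<Sum>\<^sub>\<infinity>j::int. multiquadric_hat \<alpha> c (\<xi> + 2 * pi * of_int j))"

text \<open>At the points of \<open>2\<pi>\<int>\<close>, where the quotient involves the meaningless value of
  \<^const>\<open>multiquadric_hat\<close> at \<open>0\<close>, the value is the limit of the quotient.\<close>

definition cardinal_hat :: "real \<Rightarrow> real \<Rightarrow> real \<Rightarrow> real" where
  "cardinal_hat \<alpha> c \<xi> =
     (if \<exists>m::int. \<xi> = 2 * pi * of_int m then Lim (at \<xi>) (cardinal_quotient \<alpha> c)
      else cardinal_quotient \<alpha> c \<xi>)"

end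

theory Submission
  imports Defs
begin

text \<open>
  Put \<open>\<nu> = - \<alpha> - 1/2\<close> and \<open>g(x) = \<bar>x\<bar>\<^sup>\<nu> K\<^sub>\<nu>(\<bar>x\<bar>)\<close>, suitably normalised and extended to 0.
  Up to a constant factor the transform at \<open>\<xi>\<close> is \<open>g(c\<xi>)\<close>, so the cardinal function is
  \<open>G(c\<xi>)\<close> with \<open>G = g / S\<close> and \<open>S\<close> the periodization of \<open>g\<close> with period \<open>2\<pi>c\<close>.
  The key fact is \<open>\<bar>g\<^sup>(\<^sup>i\<^sup>)\<bar> \<le> B g\<close> for all \<open>i \<le> k < 2\<nu>\<close>. Estimates of this shape pass from \<open>g\<close> to
  \<open>S\<close> term by term, and from \<open>g\<close> and \<open>S\<close> to the quotient with a constant independent of the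
  period: \<open>\<bar>G\<^sup>(\<^sup>k\<^sup>)\<bar> \<le> A G\<close>. Since the translates of \<open>G\<close> by the period sum to 1, its integral is
  \<open>2\<pi>c\<close>. Hence the \<open>L\<^sub>1\<close> norm in question is at most \<open>2\<pi>A c\<^sup>k\<close>, and the claimed exponent is
  at least \<open>k\<close>.
\<close>

section \<open>Limits and derivatives under the integral sign\<close>

text \<open>Dominated convergence along an arbitrary sequence tending to \<open>x0\<close>. The
  majorant \<open>w\<close> holds only close to \<open>x0\<close>, so an initial segment of the
  sequence is cut off first.\<close>

lemma tendsto_lebesgue_integral_at:
  fixes f :: "'a \<Rightarrow> real \<Rightarrow> real"
  assumes ev: "\<forall>\<^sub>F x in at x0. (\<lambda>t. f t x) \<in> borel_measurable M \<and> (\<forall>t. \<bar>f t x\<bar> \<le> w t)"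
    and w: "integrable M w"
    and l: "l \<in> borel_measurable M"
    and lim: "\<And>t. (f t \<longlongrightarrow> l t) (at x0)"
  shows "((\<lambda>x. \<integral>t. f t x \<partial>M) \<longlongrightarrow> (\<integral>t. l t \<partial>M)) (at x0)"
  unfolding tendsto_at_iff_sequentially
proof (intro allI impI)
  fix X assume X: "\<forall>i. X i \<in> UNIV - {x0}" "X \<longlonglongrightarrow> x0"
  then have fl: "filterlim X (at x0) sequentially"
    by (simp add: filterlim_at)
  from filterlim_iff[THEN iffD1, OF fl, rule_format, OF ev]
  obtain N where N: "\<And>n. n \<ge> N \<Longrightarrow>
      (\<lambda>t. f t (X n)) \<in> borel_measurable M \<and> (\<forall>t. \<bar>f t (X n)\<bar> \<le> w t)"
    by (auto simp: eventually_sequentially)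
  have "(\<lambda>n. \<integral>t. f t (X (n + N)) \<partial>M) \<longlonglongrightarrow> (\<integral>t. l t \<partial>M)"
  proof (rule integral_dominated_convergence[where w = w])
    show "AE t in M. (\<lambda>n. f t (X (n + N))) \<longlonglongrightarrow> l t"
      using filterlim_compose[OF lim fl] by (auto intro!: AE_I2 LIMSEQ_ignore_initial_segment)
  qed (use N w l in auto)
  then show "((\<lambda>x. \<integral>t. f t x \<partial>M) \<circ> X) \<longlonglongrightarrow> (\<integral>t. l t \<partial>M)"
    by (auto simp: o_def dest: LIMSEQ_offset)
qed

text \<open>Domination is asked for only within distance 1 of \<open>x0\<close>, so that
  \<open>w\<close> may depend on \<open>x0\<close>; periodized series have only such locally uniform
  majorants.\<close>

lemma isCont_lebesgue_integral:
  fixes f :: "'a \<Rightarrow> real \<Rightarrow> real"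
  assumes "\<And>x. (\<lambda>t. f t x) \<in> borel_measurable M"
    and "\<And>x t. \<bar>x - x0\<bar> < 1 \<Longrightarrow> \<bar>f t x\<bar> \<le> w t"
    and "integrable M w"
    and "\<And>t. isCont (f t) x0"
  shows "isCont (\<lambda>x. \<integral>t. f t x \<partial>M) x0"
  unfolding isCont_def
proof (rule tendsto_lebesgue_integral_at[where w = w])
  have "\<forall>\<^sub>F x in at x0. \<bar>x - x0\<bar> < 1"
    unfolding eventually_at by (rule exI[of _ 1]) (auto simp: dist_real_def)
  then show "\<forall>\<^sub>F x in at x0. (\<lambda>t. f t x) \<in> borel_measurable M \<and> (\<forall>t. \<bar>f t x\<bar> \<le> w t)"
    by eventually_elim (use assms in auto)
qed (use assms in \<open>auto simp: isCont_def\<close>)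

text \<open>By the mean value inequality a bound on \<open>f'\<close> near \<open>x0\<close> also
  bounds the difference quotients, to which dominated convergence then applies.\<close>

lemma has_real_derivative_lebesgue_integral:
  fixes f f' :: "'a \<Rightarrow> real \<Rightarrow> real"
  assumes int: "\<And>x. integrable M (\<lambda>t. f t x)"
    and meas: "(\<lambda>t. f' t x0) \<in> borel_measurable M"
    and der: "\<And>x t. (f t has_real_derivative f' t x) (at x)"
    and bound: "\<And>x t. \<bar>x - x0\<bar> < 1 \<Longrightarrow> \<bar>f' t x\<bar> \<le> w t"
    and w: "integrable M w"
  shows "((\<lambda>x. \<integral>t. f t x \<partial>M) has_real_derivative (\<integral>t. f' t x0 \<partial>M)) (at x0)"
proof -
  have [measurable]: "(\<lambda>t. f t x) \<in> borel_measurable M" for x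
    using int by blast
  have "((\<lambda>x. \<integral>t. (f t x - f t x0) / (x - x0) \<partial>M) \<longlongrightarrow> (\<integral>t. f' t x0 \<partial>M)) (at x0)"
  proof (rule tendsto_lebesgue_integral_at[where w = w])
    have "\<bar>(f t x - f t x0) / (x - x0)\<bar> \<le> w t" if x: "\<bar>x - x0\<bar> < 1" for t x
    proof -
      have "norm (f t x - f t x0) \<le> w t * norm (x - x0)"
      proof (rule field_differentiable_bound[of "ball x0 1" "f t" "f' t"])
        show "(f t has_real_derivative f' t z) (at z within ball x0 1)" for z
          using der by (rule has_field_derivative_at_within)
      qed (use bound x in \<open>auto simp: dist_real_def abs_minus_commute\<close>)
      moreover have "0 \<le> w t"
        using bound[of x0 t] by simp
      ultimately show ?thesis
        by (simp add: abs_divide divide_le_eq)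
    qed
    moreover have "\<forall>\<^sub>F x in at x0. \<bar>x - x0\<bar> < 1"
      unfolding eventually_at by (rule exI[of _ 1]) (auto simp: dist_real_def)
    ultimately show "\<forall>\<^sub>F x in at x0. (\<lambda>t. (f t x - f t x0) / (x - x0)) \<in> borel_measurable M \<and>
        (\<forall>t. \<bar>(f t x - f t x0) / (x - x0)\<bar> \<le> w t)"
      by (auto elim!: eventually_mono)
    show "((\<lambda>x. (f t x - f t x0) / (x - x0)) \<longlongrightarrow> f' t x0) (at x0)" for t
      using der[of t x0] by (simp add: has_field_derivative_iff)
  qed (use w meas in auto)
  moreover have "(\<integral>t. (f t x - f t x0) / (x - x0) \<partial>M)
      = ((\<integral>t. f t x \<partial>M) - (\<integral>t. f t x0 \<partial>M)) / (x - x0)" for x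
    using int by simp
  ultimately show ?thesis
    unfolding has_field_derivative_iff by (simp only: )
qed

lemma integrable_real_bound:
  fixes f g :: "'a \<Rightarrow> real"
  assumes "integrable M g" "f \<in> borel_measurable M" "\<And>x. \<bar>f x\<bar> \<le> g x"
  shows "integrable M f"
  by (rule Bochner_Integration.integrable_bound[OF assms(1,2)])
     (auto intro!: AE_I2 intro: order_trans[OF assms(3) abs_ge_self])

section \<open>Functions whose derivatives are dominated by a weight\<close>

text \<open>States that \<open>h\<close> has derivatives up to order \<open>k\<close>, all bounded
  by \<open>B * w\<close>, the last one continuous. The weight is separate from \<open>h\<close> so
  that the recursion can pass to the derivative and keep the weight. The existential keeps
  \<open>deriv\<close> out of the inductions, and continuity at the bottom makes the top derivative
  measurable.\<close>

primrec dominated_derivs ::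
  "nat \<Rightarrow> real \<Rightarrow> (real \<Rightarrow> real) \<Rightarrow> (real \<Rightarrow> real) \<Rightarrow> bool" where
  "dominated_derivs 0 B w h \<longleftrightarrow> continuous_on UNIV h \<and> (\<forall>x. \<bar>h x\<bar> \<le> B * w x)"
| "dominated_derivs (Suc k) B w h \<longleftrightarrow> (\<forall>x. \<bar>h x\<bar> \<le> B * w x) \<and>
     (\<exists>h'. (\<forall>x. (h has_real_derivative h' x) (at x)) \<and> dominated_derivs k B w h')"

lemma dominated_derivs_SucI:
  assumes "\<And>x. \<bar>h x\<bar> \<le> B * w x" "\<And>x. (h has_real_derivative h' x) (at x)"
    and "dominated_derivs k B w h'"
  shows "dominated_derivs (Suc k) B w h"
  using assms by auto

lemma dominated_derivs_SucE:
  assumes "dominated_derivs (Suc k) B w h"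
  obtains h' where "\<And>x. (h has_real_derivative h' x) (at x)" "dominated_derivs k B w h'"
  using assms by auto

lemma dominated_derivs_bound: "dominated_derivs k B w h \<Longrightarrow> \<bar>h x\<bar> \<le> B * w x"
  by (cases k) auto

lemma dominated_derivs_continuous: "dominated_derivs k B w h \<Longrightarrow> continuous_on UNIV h"
proof (cases k)
  case (Suc n)
  moreover assume "dominated_derivs k B w h"
  ultimately obtain h' where "\<And>x. (h has_real_derivative h' x) (at x)"
    by auto
  then show ?thesis
    by (meson DERIV_isCont continuous_at_imp_continuous_on)
qed simp

lemma dominated_derivs_mono:
  assumes "dominated_derivs k B w h" "B \<le> B'" "\<And>x. 0 \<le> w x"
  shows "dominated_derivs k B' w h"
proof -
  have le: "B * w x \<le> B' * w x" for x
    using assms by (simp add: mult_right_mono)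
  show ?thesis
    using assms(1)
  proof (induction k arbitrary: h)
    case 0
    then show ?case
      using order_trans[OF _ le] by simp
  next
    case (Suc k)
    then show ?case
      using order_trans[OF _ le] by simp blast
  qed
qed

lemma dominated_derivs_Suc_lower: "dominated_derivs (Suc k) B w h \<Longrightarrow> dominated_derivs k B w h"
proof (induction k arbitrary: h)
  case 0
  then show ?case
    using dominated_derivs_continuous[OF 0] by simp
next
  case (Suc k)
  from Suc.prems obtain h'
    where h': "\<And>x. (h has_real_derivative h' x) (at x)" "dominated_derivs (Suc k) B w h'"
    by (rule dominated_derivs_SucE) blast
  show ?case
    by (rule dominated_derivs_SucI[OF _ h'(1) Suc.IH[OF h'(2)]])
       (rule dominated_derivs_bound[OF Suc.prems])
qed

section \<open>Sums, products, quotients and dilations of dominated functions\<close>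

lemma dominated_derivs_add:
  assumes "dominated_derivs k B w h" "dominated_derivs k C w g"
  shows "dominated_derivs k (B + C) w (\<lambda>x. h x + g x)"
  using assms
proof (induction k arbitrary: h g)
  case 0
  have "\<bar>h x + g x\<bar> \<le> B * w x + C * w x" for x
    using 0[THEN dominated_derivs_bound, of x] by linarith
  with 0 show ?case
    by (auto intro!: continuous_intros simp: distrib_right)
next
  case (Suc k)
  obtain h' g' where *:
    "\<And>x. (h has_real_derivative h' x) (at x)" "dominated_derivs k B w h'"
    "\<And>x. (g has_real_derivative g' x) (at x)" "dominated_derivs k C w g'"
    using Suc.prems by (blast elim!: dominated_derivs_SucE)
  have "\<bar>h x + g x\<bar> \<le> B * w x + C * w x" for x
    using Suc.prems[THEN dominated_derivs_bound, of x] by linarith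
  then show ?case
    by (intro dominated_derivs_SucI[of _ _ _ "\<lambda>x. h' x + g' x"] DERIV_add Suc.IH * )
       (simp add: distrib_right)
qed

lemma dominated_derivs_cmult:
  assumes "dominated_derivs k B w h"
  shows "dominated_derivs k (\<bar>r\<bar> * B) w (\<lambda>x. r * h x)"
  using assms
proof (induction k arbitrary: h)
  case 0
  then show ?case
    by (auto intro!: continuous_intros mult_left_mono simp: abs_mult mult.assoc)
next
  case (Suc k)
  obtain h' where *:
    "\<And>x. (h has_real_derivative h' x) (at x)" "dominated_derivs k B w h'"
    using Suc.prems by (blast elim!: dominated_derivs_SucE)
  have "\<bar>r * h x\<bar> \<le> \<bar>r\<bar> * B * w x" for x
    using dominated_derivs_bound[OF Suc.prems, of x]
    by (simp add: abs_mult mult.assoc mult_left_mono)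
  then show ?case
    by (intro dominated_derivs_SucI[of _ _ _ "\<lambda>x. r * h' x"] DERIV_cmult Suc.IH * )
qed

text \<open>The weights multiply. The product rule yields two terms of the same kind at each order,
  hence the factor \<open>2 ^ k\<close>.\<close>

lemma dominated_derivs_mult:
  assumes "dominated_derivs k B v h" "dominated_derivs k C w g"
    and "0 \<le> B" "0 \<le> C" "\<And>x. 0 \<le> v x" "\<And>x. 0 \<le> w x"
  shows "dominated_derivs k (2 ^ k * (B * C)) (\<lambda>x. v x * w x) (\<lambda>x. h x * g x)"
  using assms(1,2)
proof (induction k arbitrary: h g)
  case 0
  have "\<bar>h x * g x\<bar> \<le> (B * v x) * (C * w x)" for x
    unfolding abs_mult using 0 assms(3-) by (intro mult_mono) auto
  with 0 show ?case
    by (auto intro!: continuous_intros simp: mult_ac)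
next
  case (Suc k)
  obtain h' g' where *:
    "\<And>x. (h has_real_derivative h' x) (at x)" "dominated_derivs k B v h'"
    "\<And>x. (g has_real_derivative g' x) (at x)" "dominated_derivs k C w g'"
    using Suc.prems by (blast elim!: dominated_derivs_SucE)
  have "\<bar>h x * g x\<bar> \<le> 2 ^ Suc k * (B * C) * (v x * w x)" for x
  proof -
    have "\<bar>h x * g x\<bar> \<le> (B * v x) * (C * w x)"
      unfolding abs_mult using Suc.prems assms(3-)
      by (intro mult_mono) (auto intro: dominated_derivs_bound)
    also have "\<dots> = 1 * (B * C * (v x * w x))"
      by simp
    also have "\<dots> \<le> 2 ^ Suc k * (B * C * (v x * w x))"
      using assms(3-) by (intro mult_right_mono one_le_power) auto
    finally show ?thesis
      by (simp add: mult.assoc)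
  qed
  moreover have "((\<lambda>x. h x * g x) has_real_derivative h' x * g x + h x * g' x) (at x)" for x
    using DERIV_mult[OF *(1)[of x] *(3)[of x]] by (simp add: add.commute mult.commute)
  moreover have "dominated_derivs k (2 ^ k * (B * C) + 2 ^ k * (B * C)) (\<lambda>x. v x * w x)
      (\<lambda>x. h' x * g x + h x * g' x)"
    using Suc.prems[THEN dominated_derivs_Suc_lower] by (intro dominated_derivs_add Suc.IH * )
  moreover have "2 ^ k * (B * C) + 2 ^ k * (B * C) = 2 ^ Suc k * (B * C)"
    by simp
  ultimately show ?case
    by (intro dominated_derivs_SucI) auto
qed

text \<open>The derivative of \<open>1 / s\<close> is \<open>- s' / s\<^sup>2\<close>. By the
  product rule lemma and induction its weight is \<open>s * (1 / s) * (1 / s) = 1 / s\<close>, so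
  the estimate reproduces itself. The constant is chosen before \<open>s\<close>, which later makes
  the bounds uniform in the period.\<close>

lemma dominated_derivs_inverse:
  assumes "0 \<le> B"
  shows "\<exists>A\<ge>1. \<forall>s. (\<forall>x. 0 < s x) \<and> dominated_derivs k B s s \<longrightarrow>
           dominated_derivs k A (\<lambda>x. inverse (s x)) (\<lambda>x. inverse (s x))"
proof (induction k)
  case 0
  show ?case
    by (rule exI[of _ 1]) (auto intro!: continuous_intros simp: less_imp_neq[symmetric])
next
  case (Suc k)
  then obtain A where A: "A \<ge> 1" "\<And>s. (\<forall>x. 0 < s x) \<Longrightarrow> dominated_derivs k B s s \<Longrightarrow>
           dominated_derivs k A (\<lambda>x. inverse (s x)) (\<lambda>x. inverse (s x))"
    by blast
  define A' where "A' = max 1 (2 ^ k * (B * (2 ^ k * (A * A))))"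
  have "dominated_derivs (Suc k) A' (\<lambda>x. inverse (s x)) (\<lambda>x. inverse (s x))"
    if pos: "\<forall>x. 0 < s x" and s: "dominated_derivs (Suc k) B s s" for s
  proof -
    obtain s' where s': "\<And>x. (s has_real_derivative s' x) (at x)" "dominated_derivs k B s s'"
      using s by auto
    have nn [simp]: "0 \<le> s x" "s x \<noteq> 0" for x
      using pos by (auto simp: less_imp_le less_imp_neq[symmetric])
    have inv: "dominated_derivs k A (\<lambda>x. inverse (s x)) (\<lambda>x. inverse (s x))"
      using A(2) pos s dominated_derivs_Suc_lower by blast
    have "dominated_derivs k (2 ^ k * (B * (2 ^ k * (A * A))))
        (\<lambda>x. s x * (inverse (s x) * inverse (s x)))
        (\<lambda>x. s' x * (inverse (s x) * inverse (s x)))"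
      using A(1) assms by (intro dominated_derivs_mult s' inv) auto
    then have "dominated_derivs k (2 ^ k * (B * (2 ^ k * (A * A)))) (\<lambda>x. inverse (s x))
        (\<lambda>x. s' x * (inverse (s x) * inverse (s x)))"
      by (simp add: mult.assoc[symmetric])
    from dominated_derivs_cmult[OF this, of "-1"]
    have "dominated_derivs k A' (\<lambda>x. inverse (s x))
        (\<lambda>x. - (s' x * (inverse (s x) * inverse (s x))))"
      by (auto simp: A'_def elim!: dominated_derivs_mono)
    moreover have "((\<lambda>x. inverse (s x)) has_real_derivative
        - (s' x * (inverse (s x) * inverse (s x)))) (at x)" for x
      using DERIV_inverse'[OF s'(1)[of x]] by (simp add: mult_ac)
    moreover have "\<bar>inverse (s x)\<bar> \<le> A' * inverse (s x)" for x
      using mult_right_mono[of 1 A' "inverse (s x)"] by (simp add: A'_def)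
    ultimately show ?thesis
      by (intro dominated_derivs_SucI)
  qed
  then show ?case
    by (intro exI[of _ A']) (auto simp: A'_def)
qed

lemma dominated_derivs_divide:
  assumes "0 \<le> B"
  shows "\<exists>A\<ge>0. \<forall>g s. (\<forall>x. 0 \<le> g x) \<and> (\<forall>x. 0 < s x) \<and> dominated_derivs k B g g \<and>
           dominated_derivs k B s s \<longrightarrow> dominated_derivs k A (\<lambda>x. g x / s x) (\<lambda>x. g x / s x)"
proof -
  from dominated_derivs_inverse[OF assms, of k] obtain A where A: "A \<ge> 1"
    "\<And>s. (\<forall>x. 0 < s x) \<Longrightarrow> dominated_derivs k B s s \<Longrightarrow>
           dominated_derivs k A (\<lambda>x. inverse (s x)) (\<lambda>x. inverse (s x))"
    by blast
  have "dominated_derivs k (2 ^ k * (B * A)) (\<lambda>x. g x / s x) (\<lambda>x. g x / s x)"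
    if "\<forall>x. 0 \<le> g x" "\<forall>x. 0 < s x" "dominated_derivs k B g g" "dominated_derivs k B s s" for g s
    unfolding divide_inverse using that A assms
    by (intro dominated_derivs_mult) (auto simp: less_imp_le)
  then show ?thesis
    using A assms by (intro exI[of _ "2 ^ k * (B * A)"]) auto
qed

text \<open>Each derivative brings out one factor \<open>c\<close>; as \<open>1 \<le> c\<close>, the
  lower orders are covered by \<open>c ^ k\<close> too.\<close>

lemma dominated_derivs_scale:
  assumes "dominated_derivs k B w h" "1 \<le> c" "0 \<le> B" "\<And>x. 0 \<le> w x"
  shows "dominated_derivs k (B * c ^ k) (\<lambda>x. w (c * x)) (\<lambda>x. h (c * x))"
  using assms(1)
proof (induction k arbitrary: h)
  case 0
  then show ?case
    by (auto intro!: continuous_on_compose2[of UNIV h] continuous_intros)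
next
  case (Suc k)
  obtain h' where *: "\<And>x. (h has_real_derivative h' x) (at x)" "dominated_derivs k B w h'"
    using Suc.prems by (blast elim!: dominated_derivs_SucE)
  have "\<bar>h (c * x)\<bar> \<le> B * c ^ Suc k * w (c * x)" for x
  proof -
    have "\<bar>h (c * x)\<bar> \<le> 1 * (B * w (c * x))"
      using dominated_derivs_bound[OF Suc.prems] by simp
    also have "\<dots> \<le> c ^ Suc k * (B * w (c * x))"
      using assms(2-) by (intro mult_right_mono one_le_power) auto
    finally show ?thesis
      by (simp add: mult_ac)
  qed
  moreover have "((\<lambda>x. h (c * x)) has_real_derivative c * h' (c * x)) (at x)" for x
    by (rule DERIV_cong[OF DERIV_chain2[OF *(1)]]) (auto intro!: derivative_eq_intros)
  moreover have "dominated_derivs k (B * c ^ Suc k) (\<lambda>x. w (c * x)) (\<lambda>x. c * h' (c * x))"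
    using dominated_derivs_cmult[OF Suc.IH[OF *(2)], of c] assms(2) by (simp add: mult_ac)
  ultimately show ?case
    by (rule dominated_derivs_SucI)
qed

text \<open>Uniqueness of derivatives identifies the existentially given ones with the iterates of
  \<open>deriv\<close>.\<close>

lemma dominated_derivs_funpow_deriv:
  assumes "dominated_derivs k B w h" "i \<le> k"
  shows "dominated_derivs (k - i) B w ((deriv ^^ i) h)"
  using assms(2)
proof (induction i)
  case 0
  then show ?case using assms by simp
next
  case (Suc i)
  then have "dominated_derivs (Suc (k - Suc i)) B w ((deriv ^^ i) h)"
    by (simp add: Suc_diff_Suc)
  then obtain h' where h': "\<And>x. ((deriv ^^ i) h has_real_derivative h' x) (at x)"
      "dominated_derivs (k - Suc i) B w h'"
    by auto
  moreover from h'(1) have "deriv ((deriv ^^ i) h) = h'"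
    by (auto intro!: DERIV_imp_deriv)
  ultimately show ?case
    by simp
qed

lemma dominated_derivs_differentiable:
  assumes "dominated_derivs k B w h" "i < k"
  shows "(deriv ^^ i) h differentiable (at x)"
proof -
  have "dominated_derivs (Suc (k - Suc i)) B w ((deriv ^^ i) h)"
    using dominated_derivs_funpow_deriv[OF assms(1), of i] assms(2) by (simp add: Suc_diff_Suc)
  then show ?thesis
    by (auto simp: real_differentiable_def)
qed

section \<open>Periodization\<close>

text \<open>The integers are the union of the nonnegative and the nonpositive ones, and each half
  gives a geometric series.\<close>

lemma integrable_count_space_exp_abs_int:
  assumes "0 < r"
  shows "integrable (count_space UNIV) (\<lambda>j::int. exp (- r * \<bar>of_int j\<bar>) :: real)"
proof -
  let ?f = "\<lambda>j::int. exp (- r * \<bar>of_int j\<bar>) :: real"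
  have *: "summable (\<lambda>n. exp (- r * real n))"
    using summable_geometric[of "exp (- r)"] assms
    by (simp add: exp_of_nat2_mult[of "- r", simplified])
  have nat: "(\<lambda>n::nat. exp (- r * real n)) summable_on UNIV"
    by (rule norm_summable_imp_summable_on) (use * in simp)
  have 1: "?f summable_on range int"
    by (subst summable_on_reindex) (use nat in \<open>auto simp: o_def\<close>)
  have 2: "?f summable_on range (\<lambda>n. - int n)"
    by (subst summable_on_reindex) (use nat in \<open>auto simp: o_def inj_on_def\<close>)
  have "?f summable_on (range int \<union> range (\<lambda>n. - int n))"
    by (rule summable_on_union[OF 1 2])
  also have "range int \<union> range (\<lambda>n. - int n) = UNIV"
    by (auto simp: image_iff) (metis int_cases2)
  finally have "Infinite_Sum.abs_summable_on ?f UNIV"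
    by simp
  then show ?thesis
    unfolding abs_summable_equivalent by (simp add: abs_summable_on_def)
qed

text \<open>The sum over all translates is written as an integral for the counting measure, so that
  the results on limits and derivatives under the integral sign apply to it.\<close>

definition periodization :: "real \<Rightarrow> (real \<Rightarrow> real) \<Rightarrow> real \<Rightarrow> real" where
  "periodization p f x = (\<integral>j. f (x + p * real_of_int j) \<partial>count_space UNIV)"

text \<open>The triangle inequality moves the decay from \<open>x + p * j\<close> to
  \<open>j\<close>, at the price of a factor that is the same for all \<open>x\<close> within
  distance 1 of \<open>y\<close>.\<close>

lemma exp_decay_shift_le:
  fixes x y p :: real and j :: int
  assumes "0 < p" "\<bar>x - y\<bar> \<le> 1"
  shows "exp (- \<bar>x + p * of_int j\<bar> / 2) \<le> exp ((\<bar>y\<bar> + 1) / 2) * exp (- (p / 2) * \<bar>of_int j\<bar>)"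
proof -
  have "p * \<bar>of_int j\<bar> = \<bar>p * of_int j\<bar>"
    using assms by (simp add: abs_mult)
  moreover have "\<bar>p * of_int j\<bar> \<le> \<bar>x + p * of_int j\<bar> + \<bar>y\<bar> + 1"
    using assms(2) by linarith
  ultimately have "- \<bar>x + p * of_int j\<bar> / 2 \<le> (\<bar>y\<bar> + 1) / 2 + - (p / 2) * \<bar>of_int j\<bar>"
    by (simp add: field_simps)
  then show ?thesis
    unfolding exp_add[symmetric] by (simp only: exp_le_cancel_iff)
qed

lemma integrable_periodization:
  fixes f :: "real \<Rightarrow> real"
  assumes p: "0 < p" and f: "\<And>x. \<bar>f x\<bar> \<le> C * exp (- \<bar>x\<bar> / 2)"
  shows "integrable (count_space UNIV) (\<lambda>j::int. f (x + p * of_int j))"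
proof (rule integrable_real_bound)
  show "integrable (count_space UNIV)
      (\<lambda>j::int. C * (exp ((\<bar>x\<bar> + 1) / 2) * exp (- (p / 2) * \<bar>of_int j\<bar>)))"
    using p by (intro integrable_mult_right integrable_count_space_exp_abs_int) simp
  have "0 \<le> C"
    using f[of 0] by simp
  then show "\<bar>f (x + p * of_int j)\<bar>
      \<le> C * (exp ((\<bar>x\<bar> + 1) / 2) * exp (- (p / 2) * \<bar>of_int j\<bar>))" for j :: int
    using exp_decay_shift_le[OF p, of x x j]
    by (intro order_trans[OF f] mult_left_mono) auto
qed simp

lemma infsum_eq_periodization:
  assumes "0 < p" "\<And>x. \<bar>f x\<bar> \<le> C * exp (- \<bar>x\<bar> / 2)"
  shows "(\<Sum>\<^sub>\<infinity>j::int. f (x + p * of_int j)) = periodization p f x"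
proof -
  have "Infinite_Set_Sum.abs_summable_on (\<lambda>j::int. f (x + p * of_int j)) UNIV"
    using integrable_periodization[OF assms] by (simp add: abs_summable_on_def)
  from infsetsum_infsum[OF this] show ?thesis
    by (simp add: infsetsum_def periodization_def)
qed

text \<open>The bounds add up term by term, so the constant \<open>B\<close> stays the same for
  every period \<open>p\<close>. The decay of \<open>w\<close> is used only to justify continuity
  and differentiation of the series.\<close>

lemma dominated_derivs_periodization:
  assumes p: "0 < p" and B: "0 \<le> B"
    and w: "\<And>x. 0 \<le> w x" "\<And>x. w x \<le> C * exp (- \<bar>x\<bar> / 2)"
    and h: "dominated_derivs k B w h"
  shows "dominated_derivs k B (periodization p w) (periodization p h)"
proof -
  have decay: "\<bar>f x\<bar> \<le> (B * C) * exp (- \<bar>x\<bar> / 2)" if "dominated_derivs k B w f" for f x k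
    using order_trans[OF dominated_derivs_bound[OF that] mult_left_mono[OF w(2) B]]
    by (simp add: mult.assoc)
  have C: "0 \<le> C"
    using w(1)[of 0] w(2)[of 0] by simp
  have int_w: "integrable (count_space UNIV) (\<lambda>j::int. w (x + p * of_int j))" for x
    using w by (intro integrable_periodization[OF p]) simp
  have bound: "\<bar>periodization p f x\<bar> \<le> B * periodization p w x"
    if f: "dominated_derivs k B w f" for f x k
  proof -
    have "\<bar>periodization p f x\<bar> \<le> (\<integral>j. \<bar>f (x + p * real_of_int j)\<bar> \<partial>count_space UNIV)"
      unfolding periodization_def by (rule integral_abs_bound)
    also have "\<dots> \<le> (\<integral>j. B * w (x + p * real_of_int j) \<partial>count_space UNIV)"
      using integrable_periodization[OF p decay[OF f]] int_w dominated_derivs_bound[OF f]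
      by (intro integral_mono) auto
    finally show ?thesis
      by (simp add: periodization_def)
  qed
  \<comment> \<open>A summable majorant, uniform for \<open>x\<close> within distance 1 of
    \<open>y\<close>, as the theorems on limits under the integral require.\<close>
  have local_bound: "\<bar>f (x + p * real_of_int j)\<bar>
      \<le> (B * C) * (exp ((\<bar>y\<bar> + 1) / 2) * exp (- (p / 2) * \<bar>real_of_int j\<bar>))"
    if "dominated_derivs k B w f" "\<bar>x - y\<bar> < 1" for f x y j k
    using exp_decay_shift_le[OF p, of x y j] that(2) B C
    by (intro order_trans[OF decay[OF that(1)]] mult_left_mono) auto
  have int_bound: "integrable (count_space UNIV)
      (\<lambda>j::int. (B * C) * (exp ((\<bar>y\<bar> + 1) / 2) * exp (- (p / 2) * \<bar>real_of_int j\<bar>)))" for y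
    using p by (intro integrable_mult_right integrable_count_space_exp_abs_int) simp
  show ?thesis
    using h
  proof (induction k arbitrary: h)
    case 0
    then have cont: "isCont h x" for x
      by (simp add: continuous_on_eq_continuous_at)
    have "isCont (\<lambda>x. h (x + p * real_of_int j)) x" for x and j :: int
      by (rule isCont_o2[where f = "\<lambda>x. x + p * real_of_int j", OF _ cont]) simp
    then have "isCont (periodization p h) y" for y
      unfolding periodization_def
      by (intro isCont_lebesgue_integral[OF _ local_bound[OF 0] int_bound]) auto
    then show ?case
      using bound[OF 0] by (simp add: continuous_at_imp_continuous_on)
  next
    case (Suc k)
    obtain h' where h': "\<And>x. (h has_real_derivative h' x) (at x)" "dominated_derivs k B w h'"
      using dominated_derivs_SucE[OF Suc.prems] by blast
    have "((\<lambda>x. h (x + p * real_of_int j)) has_real_derivative h' (x + p * real_of_int j)) (at x)"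
      for x and j :: int
      by (subst DERIV_shift[symmetric]) (rule h'(1))
    then have "(periodization p h has_real_derivative periodization p h' y) (at y)" for y
      unfolding periodization_def
      by (intro has_real_derivative_lebesgue_integral[OF _ _ _ local_bound[OF h'(2)] int_bound]
          integrable_periodization[OF p decay[OF Suc.prems]]) auto
    then show ?case
      by (intro dominated_derivs_SucI[OF bound[OF Suc.prems] _ Suc.IH[OF h'(2)]])
  qed
qed

lemma periodization_pos:
  assumes p: "0 < p" and g: "\<And>x. 0 < g x" "\<And>x. g x \<le> C * exp (- \<bar>x\<bar> / 2)"
  shows "0 < periodization p g x"
proof -
  have "integrable (count_space UNIV) (\<lambda>j::int. g (x + p * of_int j))"
    using g by (intro integrable_periodization[OF p]) (auto simp: less_imp_le)
  moreover have "periodization p g x \<noteq> 0"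
    unfolding periodization_def using g(1) calculation
    by (subst integral_nonneg_eq_0_iff_AE)
       (auto simp: AE_count_space less_imp_le less_imp_neq[symmetric])
  moreover have "0 \<le> periodization p g x"
    unfolding periodization_def using g(1) by (intro integral_nonneg_AE) (auto simp: less_imp_le)
  ultimately show ?thesis
    by simp
qed

lemma periodization_shift:
  "periodization p f (x + p * of_int i) = periodization p f x"
proof -
  have "bij_betw (\<lambda>j. i + j) UNIV (UNIV :: int set)"
    by (rule bij_plus)
  from integral_bij_count_space[OF this, of "\<lambda>j. f (x + p * of_int j)"] show ?thesis
    by (simp add: periodization_def algebra_simps)
qed

section \<open>Integrals over the line by unfolding into periods\<close>

lemma nn_integral_unfold_period:
  fixes f :: "real \<Rightarrow> ennreal"
  assumes p: "0 < p" and [measurable]: "f \<in> borel_measurable borel"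
  shows "(\<integral>\<^sup>+x. f x \<partial>lborel)
    = (\<integral>\<^sup>+x\<in>{0..<p}. (\<integral>\<^sup>+j. f (x + p * real_of_int j) \<partial>count_space UNIV) \<partial>lborel)"
proof -
  \<comment> \<open>The cells \<open>[p * j, p + p * j)\<close> partition the line, the index of the
    cell of \<open>x\<close> being the floor of \<open>x / p\<close>. Tonelli and a translation of
    each cell to \<open>[0, p)\<close> then give the claim.\<close>
  have cell: "x \<in> {p * of_int j..<p + p * of_int j} \<longleftrightarrow> \<lfloor>x / p\<rfloor> = j" for x and j :: int
    using p by (simp add: floor_eq_iff pos_le_divide_eq pos_divide_less_eq algebra_simps)
  have "(\<integral>\<^sup>+x. f x \<partial>lborel)
      = (\<integral>\<^sup>+x. (\<integral>\<^sup>+j. f x * indicator {p * of_int j..<p + p * of_int j} x \<partial>count_space UNIV) \<partial>lborel)"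
  proof (rule nn_integral_cong)
    fix x
    have "(\<integral>\<^sup>+j. f x * indicator {p * of_int j..<p + p * of_int j} x \<partial>count_space UNIV)
        = (\<integral>\<^sup>+j. f x * indicator {\<lfloor>x / p\<rfloor>} j \<partial>count_space UNIV)"
      by (intro nn_integral_cong) (simp add: indicator_def cell eq_commute del: atLeastLessThan_iff)
    also have "\<dots> = f x"
      by (subst nn_integral_cmult) auto
    finally show "f x = (\<integral>\<^sup>+j. f x * indicator {p * of_int j..<p + p * of_int j} x \<partial>count_space UNIV)"
      by simp
  qed
  also have "\<dots> = (\<integral>\<^sup>+j. (\<integral>\<^sup>+x. f x * indicator {p * of_int j..<p + p * of_int j} x \<partial>lborel) \<partial>count_space UNIV)"
    by (rule nn_integral_count_space_nn_integral) auto
  also have "\<dots> = (\<integral>\<^sup>+j. (\<integral>\<^sup>+x. f (x + p * of_int j) * indicator {0..<p} x \<partial>lborel) \<partial>count_space UNIV)"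
  proof (rule nn_integral_cong)
    fix j :: int
    show "(\<integral>\<^sup>+x. f x * indicator {p * of_int j..<p + p * of_int j} x \<partial>lborel)
        = (\<integral>\<^sup>+x. f (x + p * of_int j) * indicator {0..<p} x \<partial>lborel)"
      by (subst nn_integral_real_affine[where c = 1 and t = "p * of_int j"])
         (auto intro!: nn_integral_cong simp: indicator_def add.commute)
  qed
  also have "\<dots> = (\<integral>\<^sup>+x. (\<integral>\<^sup>+j. f (x + p * of_int j) * indicator {0..<p} x \<partial>count_space UNIV) \<partial>lborel)"
    by (rule nn_integral_count_space_nn_integral[symmetric]) auto
  also have "\<dots> = (\<integral>\<^sup>+x\<in>{0..<p}. (\<integral>\<^sup>+j. f (x + p * real_of_int j) \<partial>count_space UNIV) \<partial>lborel)"
    by (intro nn_integral_cong nn_integral_multc) auto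
  finally show ?thesis .
qed

text \<open>The denominator is periodic, so the translates of the quotient sum to 1 at every point.
  After unfolding, the integral is that of 1 over one period.\<close>

lemma has_bochner_integral_divide_periodization:
  assumes p: "0 < p" and g: "\<And>x. 0 < g x" "\<And>x. g x \<le> C * exp (- \<bar>x\<bar> / 2)"
    and meas [measurable]: "g \<in> borel_measurable borel" "periodization p g \<in> borel_measurable borel"
  shows "has_bochner_integral lborel (\<lambda>x. g x / periodization p g x) p"
proof (rule has_bochner_integral_nn_integral)
  have pos: "0 < periodization p g x" for x
    using p g by (rule periodization_pos)
  have int: "integrable (count_space UNIV) (\<lambda>j::int. g (x + p * of_int j))" for x
    using g by (intro integrable_periodization[OF p]) (auto simp: less_imp_le)
  have "(\<integral>\<^sup>+j. ennreal (g (x + p * real_of_int j) / periodization p g (x + p * real_of_int j)) \<partial>count_space UNIV) = 1"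
    for x
  proof -
    have "(\<integral>\<^sup>+j. ennreal (g (x + p * real_of_int j) / periodization p g x) \<partial>count_space UNIV)
        = ennreal (\<integral>j. g (x + p * real_of_int j) / periodization p g x \<partial>count_space UNIV)"
      using int g(1) pos by (intro nn_integral_eq_integral) (auto simp: less_imp_le)
    also have "\<dots> = ennreal (periodization p g x / periodization p g x)"
      by (simp add: periodization_def)
    finally show ?thesis
      using pos[of x] by (simp add: periodization_shift)
  qed
  then show "(\<integral>\<^sup>+x. ennreal (g x / periodization p g x) \<partial>lborel) = ennreal p"
    using p by (subst nn_integral_unfold_period[OF p]) auto
  show "AE x in lborel. 0 \<le> g x / periodization p g x"
    using g(1) pos by (auto simp: less_imp_le)
qed (use p in auto)

section \<open>The Bessel kernel as a mixture of Gaussians\<close>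

text \<open>The majorant is a multiple of \<open>exp (- q * \<bar>t\<bar>)\<close>: for positive
  \<open>t\<close> the term \<open>d * exp t\<close> outgrows any linear one, for negative
  \<open>t\<close> the factor \<open>exp (p * t)\<close> decays by itself.\<close>

lemma integrable_exp_minus_exp:
  fixes p d :: real
  assumes p: "0 < p" and d: "0 < d"
  shows "integrable lborel (\<lambda>t. exp (p * t - d * exp t))"
proof -
  \<comment> \<open>\<open>q \<le> 1\<close> serves the positive half line and
    \<open>q \<le> p\<close> the negative one. \<open>K\<close> is the exponential of the maximum of
    \<open>(p + 1) * t - d * t\<^sup>2 / 2\<close>, found by completing the square.\<close>
  define q where "q = min p 1"
  define K where "K = exp ((p + 1)\<^sup>2 / (2 * d))"
  have q: "0 < q" "q \<le> p" "q \<le> 1"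
    using p by (auto simp: q_def)
  have half: "integrable lborel (\<lambda>t. indicator {0..} t * exp (- q * t))"
  proof -
    have "(\<lambda>t. exp (- q * t)) absolutely_integrable_on {0..}"
      by (rule nonnegative_absolutely_integrable_1[OF integrable_on_exp_minus_to_infinity[OF q(1)]]) simp
    then have "integrable lebesgue (\<lambda>t. indicator {0..} t * exp (- q * t))"
      by (simp add: set_integrable_def)
    then show ?thesis
      by (subst (asm) integrable_completion) auto
  qed
  from lborel_integrable_real_affine[OF this, of "-1" 0]
  have "integrable lborel (\<lambda>t. indicator {0..} (- t) * exp (q * t))"
    by simp
  with half have "integrable lborel
      (\<lambda>t. K * (indicator {0..} t * exp (- q * t) + indicator {0..} (- t) * exp (q * t)))"
    by (intro integrable_mult_right Bochner_Integration.integrable_add)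
  then show ?thesis
  proof (rule integrable_real_bound)
    fix t :: real
    have "exp (p * t - d * exp t)
        \<le> K * (indicator {0..} t * exp (- q * t) + indicator {0..} (- t) * exp (q * t))"
    proof (cases "0 \<le> t")
      case True
      have "d * (t\<^sup>2 / 2) \<le> d * exp t"
        using d exp_lower_Taylor_quadratic[OF True] True by (intro mult_left_mono) auto
      moreover have "(p + 1) * t - d * (t\<^sup>2 / 2) \<le> (p + 1)\<^sup>2 / (2 * d)"
      proof -
        have "0 \<le> (p + 1 - d * t)\<^sup>2 / (2 * d)"
          using d by simp
        also have "\<dots> = (p + 1)\<^sup>2 / (2 * d) - (p + 1) * t + d * (t\<^sup>2 / 2)"
          using d by (simp add: power2_eq_square field_simps)
        finally show ?thesis by simp
      qed
      moreover have "q * t \<le> t"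
        using True q by (simp add: mult_left_le_one_le)
      ultimately have "p * t - d * exp t \<le> (p + 1)\<^sup>2 / (2 * d) + (- q * t)"
        by (simp add: algebra_simps)
      then have "exp (p * t - d * exp t) \<le> K * exp (- q * t)"
        unfolding K_def exp_add[symmetric] by (simp only: exp_le_cancel_iff)
      also have "\<dots> \<le> K * (indicator {0..} t * exp (- q * t) + indicator {0..} (- t) * exp (q * t))"
        using True by (intro mult_left_mono) (auto simp: K_def)
      finally show ?thesis .
    next
      case False
      have "p * t \<le> q * t"
        using False q by (simp add: mult_right_mono_neg)
      moreover have "0 < d * exp t"
        using d by simp
      ultimately have "exp (p * t - d * exp t) \<le> 1 * exp (q * t)"
        by simp
      also have "\<dots> \<le> K * exp (q * t)"
        using d by (intro mult_right_mono) (auto simp: K_def)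
      finally show ?thesis
        using False by simp
    qed
    then show "\<bar>exp (p * t - d * exp t)\<bar>
        \<le> K * (indicator {0..} t * exp (- q * t) + indicator {0..} (- t) * exp (q * t))"
      by simp
  qed simp
qed

text \<open>With \<open>s = exp t\<close> this is \<open>x ^ n\<close> times the classical kernel
  \<open>s powr p * exp (- s - x\<^sup>2 / (4 * s)) / s\<close> representing
  \<open>2 * (x / 2) powr p * K\<^sub>p x\<close>. Unlike the cosh integral it is smooth in \<open>x\<close> across 0;
  the power of \<open>x\<close> stays under the integral because only the product is integrable at
  \<open>x = 0\<close> when \<open>p \<le> 0\<close>.\<close>

definition heat_kernel :: "real \<Rightarrow> nat \<Rightarrow> real \<Rightarrow> real \<Rightarrow> real" where
  "heat_kernel p n t x = x ^ n * exp (p * t - exp t - x\<^sup>2 * exp (- t) / 4)"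

definition matern :: "real \<Rightarrow> nat \<Rightarrow> real \<Rightarrow> real" where
  "matern p n x = (\<integral>t. heat_kernel p n t x \<partial>lborel)"

lemma measurable_heat_kernel [measurable]:
  "(\<lambda>t. heat_kernel p n t x) \<in> borel_measurable borel"
  unfolding heat_kernel_def by measurable

section \<open>Bounds, integrability and derivatives of the kernel\<close>

lemma power_le_exp:
  fixes y :: real
  assumes "0 \<le> y"
  shows "y ^ n \<le> real n ^ n * exp y"
proof (cases "n = 0")
  case False
  have "(y / real n) ^ n \<le> exp (y / real n) ^ n"
    using assms exp_ge_add_one_self[of "y / real n"] by (intro power_mono) (linarith | simp)+
  also have "\<dots> = exp y"
    using False by (simp add: exp_of_nat_mult[symmetric])
  finally show ?thesis
    using False by (simp add: power_divide field_simps)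
qed (use assms in auto)

text \<open>In terms of \<open>z = x * exp (- t / 2)\<close> the Gaussian factor is
  \<open>exp (- z\<^sup>2 / 4)\<close>, which absorbs \<open>\<bar>z\<bar> ^ n\<close>. Trading
  \<open>x ^ n\<close> for \<open>z ^ n\<close> raises the exponent \<open>p\<close> by
  \<open>n / 2\<close>, and the bound no longer involves \<open>x\<close>.\<close>

lemma heat_kernel_bound:
  "\<exists>C\<ge>0. \<forall>p t x. \<bar>heat_kernel p n t x\<bar> \<le> C * exp ((p + real n / 2) * t - exp t)"
proof -
  define C where "C = 1 + 4 ^ n * real n ^ n"
  have C: "\<bar>z\<bar> ^ n * exp (- z\<^sup>2 / 4) \<le> C" for z :: real
  proof -
    \<comment> \<open>Squaring turns the possibly odd power into a power of
      \<open>z\<^sup>2 / 4\<close>, to be compared with the exponential.\<close>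
    have "\<bar>z\<bar> ^ n \<le> 1 + (\<bar>z\<bar> ^ n)\<^sup>2"
    proof -
      have "a \<le> 1 + a\<^sup>2" if "0 \<le> a" for a :: real
        using zero_le_power2[of "a - 1"] that by (simp add: power2_eq_square algebra_simps)
      then show ?thesis
        by simp
    qed
    also have "(\<bar>z\<bar> ^ n)\<^sup>2 = 4 ^ n * (z\<^sup>2 / 4) ^ n"
    proof -
      have "(\<bar>z\<bar> ^ n)\<^sup>2 = (\<bar>z\<bar>\<^sup>2) ^ n"
        by (simp only: power_mult[symmetric] mult.commute)
      also have "\<dots> = (4 * (z\<^sup>2 / 4)) ^ n"
        by simp
      finally show ?thesis
        by (simp only: power_mult_distrib)
    qed
    also have "\<dots> \<le> 4 ^ n * (real n ^ n * exp (z\<^sup>2 / 4))"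
      by (intro mult_left_mono power_le_exp) auto
    also have "1 + \<dots> \<le> C * exp (z\<^sup>2 / 4)"
      by (simp add: C_def algebra_simps)
    finally show ?thesis
      by (simp add: exp_minus field_simps)
  qed
  have "\<bar>heat_kernel p n t x\<bar> \<le> C * exp ((p + real n / 2) * t - exp t)" for p t x
  proof -
    define z where "z = x * exp (- t / 2)"
    have "z\<^sup>2 = x\<^sup>2 * exp (- t)"
      by (simp add: z_def power_mult_distrib exp_double[symmetric])
    moreover have "\<bar>z\<bar> ^ n = \<bar>x\<bar> ^ n * exp (- (real n / 2) * t)"
      by (simp add: z_def abs_mult power_mult_distrib exp_of_nat_mult[symmetric])
    ultimately have "\<bar>heat_kernel p n t x\<bar>
        = (\<bar>z\<bar> ^ n * exp (- z\<^sup>2 / 4)) * exp ((p + real n / 2) * t - exp t)"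
      by (simp add: heat_kernel_def abs_mult power_abs mult.assoc exp_add[symmetric] algebra_simps)
    also have "\<dots> \<le> C * exp ((p + real n / 2) * t - exp t)"
      by (intro mult_right_mono C) simp
    finally show ?thesis .
  qed
  then show ?thesis
    by (intro exI[of _ C]) (auto simp: C_def)
qed

lemma integrable_heat_kernel:
  assumes "0 < p + real n / 2"
  shows "integrable lborel (\<lambda>t. heat_kernel p n t x)"
proof -
  obtain C where C: "\<And>p t x. \<bar>heat_kernel p n t x\<bar> \<le> C * exp ((p + real n / 2) * t - exp t)"
    using heat_kernel_bound by blast
  have "integrable lborel (\<lambda>t. C * exp ((p + real n / 2) * t - 1 * exp t))"
    using assms by (intro integrable_mult_right integrable_exp_minus_exp) auto
  then show ?thesis
    by (rule integrable_real_bound) (use C in auto)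
qed

text \<open>For fixed nonzero \<open>x\<close> the factor \<open>x ^ n\<close> is a mere constant
  and can be exchanged for \<open>x ^ m\<close> with \<open>m\<close> so large that
  \<open>p + m / 2\<close> is positive.\<close>

lemma integrable_heat_kernel_nonzero:
  assumes "x \<noteq> 0"
  shows "integrable lborel (\<lambda>t. heat_kernel p n t x)"
proof -
  obtain m :: nat where "\<bar>2 * p\<bar> < real m"
    using reals_Archimedean2 by blast
  then have "integrable lborel (\<lambda>t. heat_kernel p m t x)"
    by (intro integrable_heat_kernel) linarith
  then have "integrable lborel (\<lambda>t. x ^ n / x ^ m * heat_kernel p m t x)"
    by (rule integrable_mult_right)
  then show ?thesis
    using assms by (simp add: heat_kernel_def)
qed

lemma continuous_on_matern:
  assumes "0 < p + real n / 2"
  shows "continuous_on UNIV (matern p n)"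
proof -
  obtain C where C: "\<And>p t x. \<bar>heat_kernel p n t x\<bar> \<le> C * exp ((p + real n / 2) * t - exp t)"
    using heat_kernel_bound by blast
  have int: "integrable lborel (\<lambda>t. C * exp ((p + real n / 2) * t - exp t))"
    using integrable_exp_minus_exp[OF assms, of 1] by (intro integrable_mult_right) simp
  have "isCont (heat_kernel p n t) x" for t x
    unfolding heat_kernel_def by (intro continuous_intros) simp
  then have "isCont (matern p n) x" for x
    unfolding matern_def by (intro isCont_lebesgue_integral[OF _ C int]) auto
  then show ?thesis
    by (simp add: continuous_at_imp_continuous_on)
qed

text \<open>Differentiating the power lowers \<open>n\<close>; differentiating the Gaussian gives
  the factor \<open>- x * exp (- t) / 2\<close>, which raises \<open>n\<close> and lowers
  \<open>p\<close> by one.\<close>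

lemma has_real_derivative_matern:
  assumes n: "1 < 2 * p + real n"
  shows "(matern p n has_real_derivative
           real n * matern p (n - 1) x + (- 1 / 2) * matern (p - 1) (n + 1) x) (at x)"
proof -
  let ?h = "\<lambda>t x. real n * heat_kernel p (n - 1) t x + (- 1 / 2) * heat_kernel (p - 1) (n + 1) t x"
  obtain C where C: "\<And>p t x. \<bar>heat_kernel p (n - 1) t x\<bar> \<le> C * exp ((p + real (n - 1) / 2) * t - exp t)"
    using heat_kernel_bound by blast
  obtain D where D: "\<And>p t x. \<bar>heat_kernel p (n + 1) t x\<bar> \<le> D * exp ((p + real (n + 1) / 2) * t - exp t)"
    using heat_kernel_bound by blast
  \<comment> \<open>For \<open>n = 0\<close> the difference \<open>n - 1\<close> is 0, whence the
    case distinction; the hypothesis then gives \<open>1 < 2 * p\<close>.\<close>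
  have pos: "0 < p + real (n - 1) / 2" "0 < p - 1 + real (n + 1) / 2"
    using n by (cases n; simp add: field_simps)+
  let ?w = "\<lambda>t. real n * (C * exp ((p + real (n - 1) / 2) * t - exp t))
     + 1 / 2 * (D * exp ((p - 1 + real (n + 1) / 2) * t - exp t))"
  have "((\<lambda>x. \<integral>t. heat_kernel p n t x \<partial>lborel) has_real_derivative (\<integral>t. ?h t x \<partial>lborel)) (at x)"
  proof (rule has_real_derivative_lebesgue_integral[where w = ?w])
    show "integrable lborel (\<lambda>t. heat_kernel p n t x)" for x
      using n by (intro integrable_heat_kernel) simp
    show "integrable lborel ?w"
      using integrable_exp_minus_exp[OF pos(1) zero_less_one]
        integrable_exp_minus_exp[OF pos(2) zero_less_one]
      by (intro Bochner_Integration.integrable_add integrable_mult_right) (simp_all only: mult_1)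
    show "\<bar>?h t y\<bar> \<le> ?w t" for t y
    proof -
      have "\<bar>?h t y\<bar> \<le> real n * \<bar>heat_kernel p (n - 1) t y\<bar> + 1 / 2 * \<bar>heat_kernel (p - 1) (n + 1) t y\<bar>"
        by (rule order_trans[OF abs_triangle_ineq]) (simp add: abs_mult)
      also have "\<dots> \<le> ?w t"
        using C D by (intro add_mono mult_left_mono) auto
      finally show ?thesis .
    qed
    show "(heat_kernel p n t has_real_derivative ?h t y) (at y)" for t y
    proof -
      have "exp ((p - 1) * t - exp t - y\<^sup>2 * exp (- t) / 4)
          = exp (- t) * exp (p * t - exp t - y\<^sup>2 * exp (- t) / 4)"
        unfolding exp_add[symmetric] by (simp add: algebra_simps)
      then show ?thesis
        unfolding heat_kernel_def
        by (auto intro!: derivative_eq_intros simp: algebra_simps)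
    qed
  qed simp
  also have "(\<integral>t. ?h t x \<partial>lborel) = real n * matern p (n - 1) x + (- 1 / 2) * matern (p - 1) (n + 1) x"
    unfolding matern_def using integrable_heat_kernel[OF pos(1)] integrable_heat_kernel[OF pos(2)]
    by (subst Bochner_Integration.integral_add) auto
  finally show ?thesis
    by (simp add: matern_def[abs_def])
qed

section \<open>Relation to the Bessel function\<close>

lemma bessel_K_minus: "bessel_K (- p) x = bessel_K p x"
  by (simp add: bessel_K_def)

text \<open>The substitution of \<open>ln (y / 2) + t\<close> for \<open>t\<close> turns
  \<open>exp t + y\<^sup>2 * exp (- t) / 4\<close> into \<open>y * cosh t\<close>, and reflection
  symmetrizes \<open>exp (p * t)\<close> to \<open>cosh (p * t)\<close>. The factor 2 comes from
  folding the line onto the half line of \<open>bessel_K\<close>.\<close>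

lemma
  assumes y: "0 < y"
  shows integrable_bessel_K: "integrable lborel (\<lambda>t. exp (- y * cosh t) * cosh (p * t))"
    and matern_eq_bessel_K: "matern p n y = y ^ n * (2 * (y / 2) powr p * bessel_K p y)"
proof -
  have shift: "heat_kernel p n (ln (y / 2) + 1 * t) y
      = y ^ n * (y / 2) powr p * exp (p * t - y * cosh t)" for p t n
  proof -
    have "exp (ln (y / 2) + t) + y\<^sup>2 * exp (- (ln (y / 2) + t)) / 4 = y * cosh t"
      using y unfolding exp_minus[of "_ + _"] exp_add
      by (simp add: cosh_def exp_minus field_simps power2_eq_square)
    then have "p * (ln (y / 2) + t) - exp (ln (y / 2) + t) - y\<^sup>2 * exp (- (ln (y / 2) + t)) / 4
        = p * ln (y / 2) + (p * t - y * cosh t)"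
      by (simp add: algebra_simps)
    then show ?thesis
      using y unfolding heat_kernel_def by (simp add: exp_add powr_def mult.assoc)
  qed
  have intg: "integrable lborel (\<lambda>t. exp (p * t - y * cosh t))" for p
  proof -
    have "integrable lborel (\<lambda>t. heat_kernel p 0 (ln (y / 2) + 1 * t) y)"
      using y by (intro lborel_integrable_real_affine integrable_heat_kernel_nonzero) auto
    then show ?thesis
      using y unfolding shift by simp
  qed
  have cosh_eq: "exp (- y * cosh t) * cosh (p * t)
      = (exp (p * t - y * cosh t) + exp (- p * t - y * cosh t)) / 2" for t
  proof -
    have "exp (q * t - y * cosh t) = exp (- y * cosh t) * exp (q * t)" for q
      by (simp add: exp_add[symmetric])
    from this[of p] this[of "- p"] show ?thesis
      unfolding cosh_def[of "p * t"] by (simp add: distrib_left)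
  qed
  show int_cosh: "integrable lborel (\<lambda>t. exp (- y * cosh t) * cosh (p * t))"
    unfolding cosh_eq using intg[of p] intg[of "- p"] by simp
  have refl: "(\<integral>t. f t \<partial>lborel) = (\<integral>t. f (- t) \<partial>lborel)" for f :: "real \<Rightarrow> real"
    using lborel_integral_real_affine[of "-1" f 0] by simp
  have "(\<integral>t. exp (- p * t - y * cosh t) \<partial>lborel) = (\<integral>t. exp (p * t - y * cosh t) \<partial>lborel)"
    by (subst refl) simp
  then have "(\<integral>t. exp (- y * cosh t) * cosh (p * t) \<partial>lborel)
      = (\<integral>t. exp (p * t - y * cosh t) \<partial>lborel)"
    unfolding cosh_eq using intg[of p] intg[of "- p"] by simp
  moreover have "(\<integral>t. exp (- y * cosh t) * cosh (p * t) \<partial>lborel) = 2 * bessel_K p y"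
  proof -
    let ?f = "\<lambda>t. exp (- y * cosh t) * cosh (p * t)"
    let ?g = "\<lambda>t. indicator {0..} t * ?f t"
    have g: "integrable lborel ?g"
      using integrable_mult_indicator[OF _ int_cosh, of "{0..}"] by simp
    have g': "integrable lborel (\<lambda>t. ?g (- t))"
      using lborel_integrable_real_affine[OF g, of "-1" 0] by simp
    have "(\<integral>t. ?f t \<partial>lborel) = (\<integral>t. ?g t + ?g (- t) \<partial>lborel)"
    proof (rule integral_cong_AE)
      \<comment> \<open>The two half lines overlap in the single point 0, a null set.\<close>
      show "AE t in lborel. ?f t = ?g t + ?g (- t)"
        using AE_lborel_singleton[of 0] by eventually_elim (auto split: split_indicator)
    qed (use int_cosh g g' in auto)
    also have "\<dots> = (\<integral>t. ?g t \<partial>lborel) + (\<integral>t. ?g (- t) \<partial>lborel)"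
      by (rule Bochner_Integration.integral_add[OF g g'])
    also have "(\<integral>t. ?g (- t) \<partial>lborel) = (\<integral>t. ?g t \<partial>lborel)"
      by (rule refl[symmetric])
    finally show ?thesis
      by (simp add: bessel_K_def set_lebesgue_integral_def)
  qed
  ultimately show "matern p n y = y ^ n * (2 * (y / 2) powr p * bessel_K p y)"
    unfolding matern_def
    by (subst lborel_integral_real_affine[of 1 _ "ln (y / 2)"]) (simp_all add: shift[simplified])
qed

text \<open>The integrand increases with the absolute value of the order, since \<open>cosh\<close>
  is even and increasing on the nonnegative reals.\<close>

lemma bessel_K_mono:
  assumes "0 < y" "\<bar>p\<bar> \<le> \<bar>q\<bar>"
  shows "bessel_K p y \<le> bessel_K q y"
  unfolding bessel_K_def
proof (rule set_integral_mono)
  fix t :: real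
  have "\<bar>p * t\<bar> \<le> \<bar>q * t\<bar>"
    using assms(2) by (simp add: abs_mult mult_right_mono)
  then have "cosh \<bar>p * t\<bar> \<le> cosh \<bar>q * t\<bar>"
    by (subst cosh_real_nonneg_le_iff) auto
  then show "exp (- y * cosh t) * cosh (p * t) \<le> exp (- y * cosh t) * cosh (q * t)"
    by simp
qed (use integrable_bessel_K[OF assms(1)] in
    \<open>auto simp: set_integrable_def intro!: integrable_mult_indicator[where 'b = real, simplified]\<close>)

section \<open>Positivity and decay of the weight, and domination by it\<close>

lemma matern_0_pos:
  assumes "0 < p"
  shows "0 < matern p 0 x"
proof -
  have int: "integrable lborel (\<lambda>t. heat_kernel p 0 t x)"
    using assms by (intro integrable_heat_kernel) simp
  have pos: "0 < heat_kernel p 0 t x" for t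
    by (simp add: heat_kernel_def)
  have "matern p 0 x \<noteq> 0"
  proof
    assume "matern p 0 x = 0"
    then have "AE t in lborel. heat_kernel p 0 t x = 0"
      unfolding matern_def using int pos
      by (subst (asm) integral_nonneg_eq_0_iff_AE) (auto simp: less_imp_le)
    then have "AE t in lborel :: real measure. False"
      by eventually_elim (use pos in \<open>auto simp: less_imp_neq[symmetric]\<close>)
    then show False
      by (simp add: AE_iff_null null_sets_def)
  qed
  moreover have "0 \<le> matern p 0 x"
    unfolding matern_def using pos by (intro integral_nonneg_AE) (auto simp: less_imp_le)
  ultimately show ?thesis
    by simp
qed

text \<open>By completing the square,
  \<open>\<bar>x\<bar> \<le> exp t + x\<^sup>2 * exp (- t) / 4\<close>. Half of this estimate
  provides the decay in \<open>x\<close>; the remaining half of \<open>exp t\<close> keeps the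
  integral finite.\<close>

lemma matern_0_decay:
  assumes "0 < p"
  shows "\<exists>C. \<forall>x. matern p 0 x \<le> C * exp (- \<bar>x\<bar> / 2)"
proof -
  have "matern p 0 x \<le> (\<integral>t. exp (- \<bar>x\<bar> / 2) * exp (p * t - 1 / 2 * exp t) \<partial>lborel)" for x
    unfolding matern_def
  proof (rule integral_mono)
    show "integrable lborel (\<lambda>t. heat_kernel p 0 t x)"
      using assms by (intro integrable_heat_kernel) simp
    show "integrable lborel (\<lambda>t. exp (- \<bar>x\<bar> / 2) * exp (p * t - 1 / 2 * exp t))"
      using assms by (intro integrable_mult_right integrable_exp_minus_exp) auto
    show "heat_kernel p 0 t x \<le> exp (- \<bar>x\<bar> / 2) * exp (p * t - 1 / 2 * exp t)" for t
    proof -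
      define a b where "a = exp (t / 2)" and "b = exp (- t / 2)"
      have ab: "a * b = 1" "a\<^sup>2 = exp t" "b\<^sup>2 = exp (- t)"
        unfolding a_def b_def by (simp_all add: exp_add[symmetric] exp_double[symmetric])
      have "0 \<le> (a - \<bar>x\<bar> * b / 2)\<^sup>2"
        by simp
      also have "\<dots> = a\<^sup>2 + x\<^sup>2 * b\<^sup>2 / 4 - \<bar>x\<bar> * (a * b)"
        by (simp add: power2_diff power_mult_distrib power_divide)
      finally have "\<bar>x\<bar> \<le> exp t + x\<^sup>2 * exp (- t) / 4"
        unfolding ab by simp
      moreover have "0 \<le> x\<^sup>2 * exp (- t)"
        by simp
      ultimately have "p * t - exp t - x\<^sup>2 * exp (- t) / 4
          \<le> - \<bar>x\<bar> / 2 + (p * t - 1 / 2 * exp t)"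
        by linarith
      then show ?thesis
        unfolding heat_kernel_def exp_add[symmetric] by simp
    qed
  qed
  then show ?thesis
    by (intro exI[of _ "\<integral>t. exp (p * t - 1 / 2 * exp t) \<partial>lborel"]) (simp add: mult.commute)
qed

lemma matern_0_abs: "matern p 0 \<bar>x\<bar> = matern p 0 x"
  by (simp add: matern_def heat_kernel_def)

lemma abs_matern: "\<bar>matern p n \<bar>x\<bar>\<bar> = \<bar>matern p n x\<bar>"
proof (cases "x < 0")
  case True
  then have "heat_kernel p n t \<bar>x\<bar> = (- 1) ^ n * heat_kernel p n t x" for t
    by (simp add: heat_kernel_def power_minus[of x n])
  then show ?thesis
    by (simp add: matern_def abs_mult power_abs)
qed simp

text \<open>For \<open>\<bar>x\<bar> \<le> 1\<close> the left side is bounded and the weight is at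
  least its value at 1. Beyond that, the Bessel form reduces the claim to monotonicity in the order
  and to \<open>y powr (p + n) \<le> y powr v\<close>.\<close>

lemma matern_le_matern_0:
  assumes v: "0 < v" and p: "0 < p + real n / 2" "p + real n \<le> v"
  shows "\<exists>B\<ge>0. \<forall>x. \<bar>matern p n x\<bar> \<le> B * matern v 0 x"
proof -
  obtain C where C: "C \<ge> 0" "\<And>p t x. \<bar>heat_kernel p n t x\<bar> \<le> C * exp ((p + real n / 2) * t - exp t)"
    using heat_kernel_bound by blast
  define I where "I = (\<integral>t. C * exp ((p + real n / 2) * t - 1 * exp t) \<partial>lborel)"
  have near: "\<bar>matern p n x\<bar> \<le> I" for x
  proof -
    have "\<bar>matern p n x\<bar> \<le> (\<integral>t. \<bar>heat_kernel p n t x\<bar> \<partial>lborel)"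
      unfolding matern_def by (rule integral_abs_bound)
    also have "\<dots> \<le> I"
      unfolding I_def using p C(2)
      by (intro integral_mono integrable_abs integrable_heat_kernel integrable_mult_right
          integrable_exp_minus_exp) auto
    finally show ?thesis .
  qed
  have I: "0 \<le> I"
    using near[of 0] by simp
  \<comment> \<open>The first summand serves \<open>\<bar>x\<bar> \<le> 1\<close>, the second the
    rest of the line.\<close>
  define B where "B = I / matern v 0 1 + 2 powr (v - p)"
  have "\<bar>matern p n x\<bar> \<le> B * matern v 0 x" for x
  proof (cases "\<bar>x\<bar> \<le> 1")
    case True
    have "matern v 0 1 \<le> matern v 0 x"
      unfolding matern_def
    proof (rule integral_mono)
      show "heat_kernel v 0 t 1 \<le> heat_kernel v 0 t x" for t
        using True by (simp add: heat_kernel_def abs_square_le_1)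
    qed (use v in \<open>auto intro!: integrable_heat_kernel\<close>)
    then have "I * 1 \<le> I * (matern v 0 x / matern v 0 1)"
      using I matern_0_pos[OF v, of 1] by (intro mult_left_mono) auto
    also have "\<dots> \<le> B * matern v 0 x"
      using matern_0_pos[OF v, of x] by (simp add: B_def algebra_simps)
    finally show ?thesis
      using near[of x] by simp
  next
    case False
    define y where "y = \<bar>x\<bar>"
    have y: "1 < y"
      using False by (simp add: y_def)
    have K: "0 \<le> bessel_K q y" for q
      unfolding bessel_K_def set_lebesgue_integral_def by (intro integral_nonneg_AE) auto
    \<comment> \<open>If \<open>p\<close> is negative, then
      \<open>- p < n / 2 < p + n \<le> v\<close>.\<close>
    have "\<bar>p\<bar> \<le> \<bar>v\<bar>"
      using v p by linarith
    with y have bessel_le: "bessel_K p y \<le> bessel_K v y"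
      by (intro bessel_K_mono) auto
    have power_le: "y ^ n * (y / 2) powr p \<le> 2 powr (v - p) * (y / 2) powr v"
    proof -
      have "y ^ n * (y / 2) powr p = 2 powr (- p) * y powr (p + real n)"
        using y by (simp add: powr_divide powr_add powr_realpow powr_minus field_simps)
      also have "\<dots> \<le> 2 powr (- p) * y powr v"
        using y p by (intro mult_left_mono powr_mono) auto
      also have "\<dots> = 2 powr (v - p) * (y / 2) powr v"
        using y by (simp add: powr_divide powr_diff powr_minus field_simps)
      finally show ?thesis .
    qed
    have "(y ^ n * (y / 2) powr p) * bessel_K p y
        \<le> (2 powr (v - p) * (y / 2) powr v) * bessel_K v y"
      by (rule mult_mono[OF power_le bessel_le]) (use K in auto)
    moreover have "matern p n y = 2 * ((y ^ n * (y / 2) powr p) * bessel_K p y)"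
      "2 powr (v - p) * matern v 0 y = 2 * ((2 powr (v - p) * (y / 2) powr v) * bessel_K v y)"
      using y by (simp_all add: matern_eq_bessel_K)
    ultimately have "matern p n y \<le> 2 powr (v - p) * matern v 0 y"
      by linarith
    also have "\<dots> \<le> B * matern v 0 y"
      using I matern_0_pos[OF v] by (intro mult_right_mono) (auto simp: B_def less_imp_le)
    finally have "matern p n y \<le> B * matern v 0 y" .
    moreover have "0 \<le> matern p n y"
      using y K by (simp add: matern_eq_bessel_K)
    moreover have "matern v 0 x = matern v 0 y"
      by (simp add: y_def matern_0_abs)
    ultimately show ?thesis
      using abs_matern[of p n x, folded y_def, symmetric] by simp
  qed
  moreover have "0 \<le> B"
    using I matern_0_pos[OF v, of 1] by (auto simp: B_def)
  ultimately show ?thesis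
    by blast
qed

text \<open>A derivative leads from \<open>(p, n)\<close> to \<open>(p, n - 1)\<close> and
  \<open>(p - 1, n + 1)\<close>. Both lower \<open>2 * p + n\<close> by one and neither raises
  \<open>p + n\<close>, so the number of admissible derivatives is governed by
  \<open>2 * p + n\<close>. For \<open>n = 0\<close> the first term has coefficient 0.\<close>

lemma dominated_derivs_matern:
  assumes v: "0 < v"
  shows "real k < 2 * p + real n \<Longrightarrow> p + real n \<le> v \<Longrightarrow>
    \<exists>B\<ge>0. dominated_derivs k B (matern v 0) (matern p n)"
proof (induction k arbitrary: p n)
  case 0
  with matern_le_matern_0[OF v, of p n] continuous_on_matern[of p n] show ?case
    by (auto simp: field_simps)
next
  case (Suc k)
  have nn: "0 \<le> matern v 0 x" for x
    using matern_0_pos[OF v] by (simp add: less_imp_le)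
  obtain B1 where B1: "B1 \<ge> 0" "dominated_derivs k B1 (matern v 0) (matern p (n - 1))"
    using Suc.IH[of p "n - 1"] Suc.prems by (cases n) auto
  obtain B2 where B2: "B2 \<ge> 0" "dominated_derivs k B2 (matern v 0) (matern (p - 1) (n + 1))"
    using Suc.IH[of "p - 1" "n + 1"] Suc.prems by auto
  obtain B0 where B0: "B0 \<ge> 0" "\<And>x. \<bar>matern p n x\<bar> \<le> B0 * matern v 0 x"
    using matern_le_matern_0[OF v, of p n] Suc.prems by auto
  define B where "B = B0 + (\<bar>real n\<bar> * B1 + \<bar>- 1 / 2\<bar> * B2)"
  have B: "B0 \<le> B" "\<bar>real n\<bar> * B1 + \<bar>- 1 / 2\<bar> * B2 \<le> B" "0 \<le> B"
    using B0(1) B1(1) B2(1) by (auto simp: B_def)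
  have "dominated_derivs (Suc k) B (matern v 0) (matern p n)"
  proof (rule dominated_derivs_SucI)
    show "\<bar>matern p n x\<bar> \<le> B * matern v 0 x" for x
      using B0(2)[of x] mult_right_mono[OF B(1) nn[of x]] by linarith
    show "(matern p n has_real_derivative
        real n * matern p (n - 1) x + (- 1 / 2) * matern (p - 1) (n + 1) x) (at x)" for x
      using Suc.prems by (intro has_real_derivative_matern) auto
    show "dominated_derivs k B (matern v 0)
        (\<lambda>x. real n * matern p (n - 1) x + (- 1 / 2) * matern (p - 1) (n + 1) x)"
      by (rule dominated_derivs_mono[OF dominated_derivs_add[OF
            dominated_derivs_cmult[OF B1(2)] dominated_derivs_cmult[OF B2(2)]] B(2) nn])
  qed
  with B(3) show ?case
    by blast
qed

section \<open>The cardinal function\<close>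

text \<open>The product of \<open>c * \<bar>\<xi>\<bar> / 2\<close> and
  \<open>c / \<bar>\<xi>\<bar>\<close> is free of \<xi>, so the power in the transform matches the
  one in \<open>matern\<close> up to a constant. This constant depends on \<open>c\<close> but
  cancels in the cardinal quotient.\<close>

lemma multiquadric_hat_eq_matern:
  assumes "\<alpha> < -1" "0 < c"
  obtains C where "0 < C" "\<And>\<xi>. \<xi> \<noteq> 0 \<Longrightarrow> multiquadric_hat \<alpha> c \<xi> = C * matern (- \<alpha> - 1/2) 0 (c * \<xi>)"
proof
  define \<nu> where "\<nu> = - \<alpha> - 1/2"
  let ?C = "2 powr (1 + \<alpha>) / Gamma (- \<alpha>) * (1 / (2 * (c * c / 2) powr \<nu>))"
  show "0 < ?C"
    using assms by simp
  show "multiquadric_hat \<alpha> c \<xi> = ?C * matern (- \<alpha> - 1/2) 0 (c * \<xi>)" if "\<xi> \<noteq> 0" for \<xi>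
  proof -
    define y where "y = c * \<bar>\<xi>\<bar>"
    have y: "0 < y"
      using assms that by (simp add: y_def)
    have "matern \<nu> 0 (c * \<xi>) = matern \<nu> 0 y"
      using matern_0_abs[of \<nu> "c * \<xi>"] assms by (simp add: y_def abs_mult)
    also have "\<dots> = 2 * (y / 2) powr \<nu> * bessel_K \<nu> y"
      using matern_eq_bessel_K[OF y, of \<nu> 0] by simp
    also have "(y / 2) powr \<nu> = (c * c / 2) powr \<nu> * (c / \<bar>\<xi>\<bar>) powr (- \<nu>)"
    proof -
      have "(y / 2) powr \<nu> * (c / \<bar>\<xi>\<bar>) powr \<nu> = (c * c / 2) powr \<nu>"
        unfolding powr_mult[symmetric] using that by (simp add: y_def)
      then show ?thesis
        using assms that by (simp add: powr_minus field_simps)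
    qed
    finally have "(c / \<bar>\<xi>\<bar>) powr (- \<nu>) * bessel_K \<nu> y
        = 1 / (2 * (c * c / 2) powr \<nu>) * matern \<nu> 0 (c * \<xi>)"
      using assms by simp
    moreover have "\<alpha> + 1/2 = - \<nu>"
      by (simp add: \<nu>_def)
    ultimately show ?thesis
      unfolding multiquadric_hat_def y_def[symmetric] \<nu>_def[symmetric]
      by (simp only: bessel_K_minus mult.assoc)
  qed
qed

text \<open>Scaling by \<open>c\<close> turns the shifts by \<open>2 * pi\<close> into shifts by
  \<open>2 * pi * c\<close>. At the lattice points, continuity of the right-hand side identifies the
  limit in \<open>cardinal_hat\<close> with its value.\<close>

lemma cardinal_hat_eq_matern:
  assumes \<alpha>: "\<alpha> < -1" and c: "0 < c"
  defines "g \<equiv> matern (- \<alpha> - 1/2) 0"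
  assumes g: "\<And>x. g x \<le> C * exp (- \<bar>x\<bar> / 2)"
    and cont: "continuous_on UNIV (\<lambda>x. g x / periodization (2 * pi * c) g x)"
  shows "cardinal_hat \<alpha> c = (\<lambda>\<xi>. g (c * \<xi>) / periodization (2 * pi * c) g (c * \<xi>))"
proof
  fix \<xi>
  let ?G = "\<lambda>x. g x / periodization (2 * pi * c) g x"
  have pos: "0 < g x" for x
    using \<alpha> unfolding g_def by (intro matern_0_pos) simp
  obtain K where K: "0 < K" "\<And>\<xi>. \<xi> \<noteq> 0 \<Longrightarrow> multiquadric_hat \<alpha> c \<xi> = K * g (c * \<xi>)"
    unfolding g_def using multiquadric_hat_eq_matern[OF \<alpha> c] by blast
  have quotient: "cardinal_quotient \<alpha> c x = ?G (c * x)" if x: "\<nexists>m::int. x = 2 * pi * of_int m" for x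
  proof -
    \<comment> \<open>Off the lattice no translate hits 0, so the meaningless value of the transform
      there never enters the sum.\<close>
    have nz: "x + 2 * pi * of_int j \<noteq> 0" for j :: int
    proof
      assume "x + 2 * pi * of_int j = 0"
      then have "x = 2 * pi * of_int (- j)"
        by simp
      with x show False
        by blast
    qed
    have "multiquadric_hat \<alpha> c (x + 2 * pi * of_int j)
        = K * g (c * x + (2 * pi * c) * of_int j)" for j :: int
      using K(2)[OF nz] by (simp add: algebra_simps)
    then have "(\<Sum>\<^sub>\<infinity>j::int. multiquadric_hat \<alpha> c (x + 2 * pi * of_int j))
        = K * (\<Sum>\<^sub>\<infinity>j::int. g (c * x + (2 * pi * c) * of_int j))"
      by (simp add: infsum_cmult_right')
    also have "(\<Sum>\<^sub>\<infinity>j::int. g (c * x + (2 * pi * c) * of_int j)) = periodization (2 * pi * c) g (c * x)"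
      using pos g c by (intro infsum_eq_periodization[where C = C]) (auto simp: less_imp_le)
    finally show ?thesis
      using K(1) K(2)[of x] nz[of 0] by (simp add: cardinal_quotient_def)
  qed
  show "cardinal_hat \<alpha> c \<xi> = ?G (c * \<xi>)"
  proof (cases "\<exists>m::int. \<xi> = 2 * pi * of_int m")
    case True
    then obtain m :: int where m: "\<xi> = 2 * pi * of_int m"
      by blast
    have "isCont (\<lambda>x. ?G (c * x)) \<xi>"
    proof (rule isCont_o2[where f = "\<lambda>x. c * x" and g = ?G])
      show "isCont ?G (c * \<xi>)"
        using cont by (simp add: continuous_on_eq_continuous_at)
    qed simp
    then have lim: "((\<lambda>x. ?G (c * x)) \<longlongrightarrow> ?G (c * \<xi>)) (at \<xi>)"
      by (simp add: isCont_def)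
    \<comment> \<open>Distinct lattice points are at least \<open>2 * pi\<close> apart, so near
      \<xi> the formula for the quotient holds at all other points.\<close>
    have "\<nexists>m'::int. x = 2 * pi * of_int m'" if "x \<noteq> \<xi>" "dist x \<xi> < 2 * pi" for x
    proof
      assume "\<exists>m'::int. x = 2 * pi * of_int m'"
      then obtain m' :: int where "x = 2 * pi * of_int m'"
        by blast
      then have "dist x \<xi> = 2 * pi * of_int \<bar>m' - m\<bar>" "m' \<noteq> m"
        using that(1) by (auto simp: m dist_real_def abs_mult right_diff_distrib[symmetric])
      moreover from this(2) have "1 \<le> \<bar>m' - m\<bar>"
        by linarith
      then have "2 * pi * 1 \<le> 2 * pi * of_int \<bar>m' - m\<bar>"
        by (intro mult_left_mono) (linarith, simp)
      ultimately show False
        using that(2) by simp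
    qed
    then have "\<forall>\<^sub>F x in at \<xi>. ?G (c * x) = cardinal_quotient \<alpha> c x"
      unfolding eventually_at by (intro exI[of _ "2 * pi"]) (auto simp: quotient)
    from Lim_transform_eventually[OF lim this]
    have "Lim (at \<xi>) (cardinal_quotient \<alpha> c) = ?G (c * \<xi>)"
      by (intro tendsto_Lim) auto
    with True show ?thesis
      by (simp add: cardinal_hat_def)
  next
    case False
    then show ?thesis
      using quotient by (simp add: cardinal_hat_def)
  qed
qed

text \<open>Since \<open>deriv\<close> and the integral are total, the clauses on differentiability
  and integrability ensure that the norm bound speaks of genuine derivatives and a convergent
  integral.\<close>

theorem theorem12:
  fixes \<alpha> :: real and k :: nat
  assumes "\<alpha> < -1" and "real k < 2 * \<bar>\<alpha>\<bar> - 1"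
  shows "\<exists>A>0. \<forall>c\<ge>1.
           (\<forall>i<k. \<forall>\<xi>. (deriv ^^ i) (cardinal_hat \<alpha> c) differentiable (at \<xi>)) \<and>
           integrable lborel ((deriv ^^ k) (cardinal_hat \<alpha> c)) \<and>
           (LBINT \<xi>. \<bar>(deriv ^^ k) (cardinal_hat \<alpha> c) \<xi>\<bar>)
             \<le> A * c powr ((2 * real k + 1) * (2 * \<bar>\<alpha>\<bar> - of_int \<lfloor>\<bar>\<alpha>\<bar>\<rfloor> - 1) + real k)"
proof -
  define \<nu> where "\<nu> = - \<alpha> - 1/2"
  define g where "g = matern \<nu> 0"
  have \<nu>: "0 < \<nu>" "real k < 2 * \<nu>"
    using assms by (auto simp: \<nu>_def)
  obtain B where B: "0 \<le> B" "dominated_derivs k B g g"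
    using dominated_derivs_matern[OF \<nu>(1), of k \<nu> 0] \<nu>(2) by (auto simp: g_def)
  obtain C where C: "\<And>x. g x \<le> C * exp (- \<bar>x\<bar> / 2)"
    using matern_0_decay[OF \<nu>(1)] by (auto simp: g_def)
  have pos: "0 < g x" for x
    using matern_0_pos[OF \<nu>(1)] by (simp add: g_def)
  \<comment> \<open>\<open>A\<close> is fixed before \<open>c\<close>; it serves every denominator
    \<open>s\<close> that satisfies the estimate with \<open>B\<close>, hence every period.\<close>
  obtain A where A: "0 \<le> A" "\<And>s. (\<forall>x. 0 < s x) \<Longrightarrow> dominated_derivs k B s s \<Longrightarrow>
      dominated_derivs k A (\<lambda>x. g x / s x) (\<lambda>x. g x / s x)"
    using dominated_derivs_divide[OF B(1), of k] pos B(2) by (auto simp: less_imp_le)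
  show ?thesis
  proof (intro exI[of _ "2 * pi * A + 1"] conjI allI impI)
    show "0 < 2 * pi * A + 1"
      using A(1) by (simp add: add_nonneg_pos)
    fix c :: real
    assume c: "1 \<le> c"
    define p where "p = 2 * pi * c"
    have p: "0 < p"
      using c by (simp add: p_def)
    define G where "G = (\<lambda>x. g x / periodization p g x)"
    have per: "dominated_derivs k B (periodization p g) (periodization p g)"
      using B C pos by (intro dominated_derivs_periodization[OF p]) (auto simp: less_imp_le)
    have per_pos: "0 < periodization p g x" for x
      using p pos C by (rule periodization_pos)
    have G: "dominated_derivs k A G G"
      unfolding G_def using per per_pos by (intro A(2)) auto
    have G_nonneg: "0 \<le> G x" for x
      using pos per_pos by (simp add: G_def less_imp_le)
    have hat: "cardinal_hat \<alpha> c = (\<lambda>\<xi>. G (c * \<xi>))"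
      using cardinal_hat_eq_matern[OF assms(1), of c C, folded \<nu>_def, folded g_def p_def]
        c C dominated_derivs_continuous[OF G] by (simp add: G_def)
    let ?D = "(deriv ^^ k) (cardinal_hat \<alpha> c)"
    have L: "dominated_derivs k (A * c ^ k) (\<lambda>\<xi>. G (c * \<xi>)) (cardinal_hat \<alpha> c)"
      unfolding hat using G c A(1) G_nonneg by (intro dominated_derivs_scale)
    show "(deriv ^^ i) (cardinal_hat \<alpha> c) differentiable (at \<xi>)" if "i < k" for i \<xi>
      using L that by (rule dominated_derivs_differentiable)
    have "dominated_derivs 0 (A * c ^ k) (\<lambda>\<xi>. G (c * \<xi>)) ?D"
      using dominated_derivs_funpow_deriv[OF L order_refl] by simp
    then have D: "continuous_on UNIV ?D" "\<And>\<xi>. \<bar>?D \<xi>\<bar> \<le> A * c ^ k * G (c * \<xi>)"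
      by auto
    have "has_bochner_integral lborel G p"
      unfolding G_def using dominated_derivs_continuous[OF B(2)] dominated_derivs_continuous[OF per]
      by (intro has_bochner_integral_divide_periodization[OF p pos C] borel_measurable_continuous_onI)
    \<comment> \<open>The dilation divides the integral \<open>2 * pi * c\<close> by
      \<open>c\<close>, so that only the factor \<open>c ^ k\<close> of the derivative bound
      remains.\<close>
    from lborel_has_bochner_integral_real_affine_iff[THEN iffD1, OF _ this, of c 0] c
    have "has_bochner_integral lborel (\<lambda>\<xi>. G (c * \<xi>)) (p /\<^sub>R c)"
      by simp
    also have "p /\<^sub>R c = 2 * pi"
      using c by (simp add: p_def)
    finally have "has_bochner_integral lborel (\<lambda>\<xi>. G (c * \<xi>)) (2 * pi)" .
    then have G_int: "integrable lborel (\<lambda>\<xi>. A * c ^ k * G (c * \<xi>))"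
      "(\<integral>\<xi>. A * c ^ k * G (c * \<xi>) \<partial>lborel) = A * c ^ k * (2 * pi)"
      by (auto simp: has_bochner_integral_iff)
    show D_int: "integrable lborel ?D"
      by (rule integrable_real_bound[OF G_int(1) _ D(2)])
         (use D(1) in \<open>simp add: borel_measurable_continuous_onI\<close>)
    have "(LBINT \<xi>. \<bar>?D \<xi>\<bar>) \<le> (2 * pi * A) * c ^ k"
      using integral_mono[OF integrable_abs[OF D_int] G_int(1) D(2)] unfolding G_int(2)
      by (simp add: mult_ac)
    also have "\<dots> \<le> (2 * pi * A + 1) * c powr real k"
      using c by (simp add: powr_realpow mult_right_mono)
    also have "\<dots> \<le> (2 * pi * A + 1) * c powr ((2 * real k + 1) * (2 * \<bar>\<alpha>\<bar> - of_int \<lfloor>\<bar>\<alpha>\<bar>\<rfloor> - 1) + real k)"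
    proof (intro mult_left_mono powr_mono)
      \<comment> \<open>The floor is at most \<open>\<bar>\<alpha>\<bar>\<close> and
        \<open>\<bar>\<alpha>\<bar> > 1\<close>. So the stated exponent is at least
        \<open>k\<close>, and \<open>1 \<le> c\<close> makes its power the larger one.\<close>
      have "0 \<le> 2 * \<bar>\<alpha>\<bar> - of_int \<lfloor>\<bar>\<alpha>\<bar>\<rfloor> - 1"
        using assms(1) of_int_floor_le[of "\<bar>\<alpha>\<bar>"] by linarith
      then show "real k \<le> (2 * real k + 1) * (2 * \<bar>\<alpha>\<bar> - of_int \<lfloor>\<bar>\<alpha>\<bar>\<rfloor> - 1) + real k"
        by simp
    qed (use c A(1) in auto)
    finally show "(LBINT \<xi>. \<bar>?D \<xi>\<bar>)
        \<le> (2 * pi * A + 1) * c powr ((2 * real k + 1) * (2 * \<bar>\<alpha>\<bar> - of_int \<lfloor>\<bar>\<alpha>\<bar>\<rfloor> - 1) + real k)" .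
  qed
qed

end
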